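(* Consider the iterates $(x^k)_{k\in\mathbb N}$ and directions $(d^k)_{k\in\mathbb N}$ generated by algorithm FBTN (described in the context). Suppose that $\varphi=f+g$ satisfies the quadratic growth with some constants $(\mu,\beta)$, $\mu,\beta>0$, and that $(d^k)$ are superlinearly convergent directions (respectively, superlinearly convergent directions with order $q$, for some $q>1$). Then there exists $\bar k\in\mathbb N$ such that $$\varphi_\gamma(x^k+d^k)\le\varphi_\gamma(x^k)-\sigma\|R_\gamma(x^k)\|^2\qquad\forall k\ge\bar k.$$ In particular, for all sufficiently large $k$ the iterates reduce to $x^{k+1}=x^k+d^k$, and $\operatorname{dist}(x^k,\mathcal X_\star)$ converges to $0$ superlinearly (respectively, superlinearly with order $q$).
   Context: Setting: $f:\mathbb R^n\to\mathbb R$ is convex, twice continuously differentiable, with $L_f$-Lipschitz continuous gradient ($L_f>0$); $g:\mathbb R^n\to\mathbb R\cup\{\infty\}$ is proper, convex and lower semicontinuous; $\varphi=f+g$, $\varphi_\star=\inf\varphi$, $\mathcal X_\star=\operatorname{argmin}\varphi$. It is assumed that $\mathcal X_\star\neq\emptyset$. Quadratic growth of $\varphi$ with constants $(\mu,\beta)$ means: $\varphi(x)-\varphi_\star\ge\frac\mu2\operatorname{dist}(x,\mathcal X_\star)^2$ for all $x$ with $\varphi(x)\le\varphi_\star+\beta$. Notation, for $\gamma>0$: $\operatorname{prox}_{\gamma g}(x)=\operatorname{argmin}_w\{g(w)+\frac1{2\gamma}\|w-x\|^2\}$; $T_\gamma(x)=\operatorname{prox}_{\gamma g}(x-\gamma\nabla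 f(x))$; $R_\gamma(x)=\frac1\gamma(x-T_\gamma(x))$; $Q_\gamma(x)=I-\gamma\nabla^2 f(x)$. The forward-backward envelope is $\varphi_\gamma(x)=\min_{w\in\mathbb R^n}\{f(x)+\langle\nabla f(x),w-x\rangle+\frac1{2\gamma}\|w-x\|^2+g(w)\}=f(x)-\frac\gamma2\|\nabla f(x)\|^2+g^\gamma(x-\gamma\nabla f(x))$, where $g^\gamma(x)=\min_w\{g(w)+\frac1{2\gamma}\|w-x\|^2\}$; it is continuously differentiable with $\nabla\varphi_\gamma(x)=Q_\gamma(x)R_\gamma(x)$. For a locally Lipschitz map $G$, $\partial_CG(x)$ is the Clarke generalized Jacobian: the convex hull of all limits of Jacobians $JG(x^j)$ along sequences $x^j\to x$ of points of differentiability of $G$. The approximate generalized Hessian is $\hat\partial^2\varphi_\gamma(x)=\{\gamma^{-1}Q_\gamma(x)(I-PQ_\gamma(x)) : P\in\partial_C(\operatorname{prox}_{\gamma g})(x-\gamma\nabla f(x))\}$ (nonempty, consisting of symmetric positive semidefinite matrices when $\gamma\le 1/L_f$). Algorithm FBTN. Parameters: $\gamma\in(0,1/L_f)$, $\sigma\in(0,\frac{\gamma(1-\gamma L_f)}2)$, $\bar\eta,\zeta\in(0,1)$, $\rho,\nu\in(0,1]$, initial point $x^0\in\mathbb R^n$. For $k=0,1,2,\dots$: (1) set $\delta_k=\zeta\|\nabla\varphi_\gamma(x^k)\|^\nu$, $\eta_k=\min\{\bar\eta,\|\nabla\varphi_\gamma(x^k)\|^\rho\}$, $\varepsilon_k=\eta_k\|\nabla\varphi_\gamma(x^k)\|$;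 (2) for some $H_k\in\hat\partial^2\varphi_\gamma(x^k)$, find (by the conjugate gradient method) an $\varepsilon_k$-approximate solution $d^k$ of the linear system $(H_k+\delta_kI)d=-\nabla\varphi_\gamma(x^k)$, i.e. $\|(H_k+\delta_kI)d^k+\nabla\varphi_\gamma(x^k)\|\le\varepsilon_k$; (3) let $\tau_k$ be the maximum in $\{2^{-i}: i=0,1,2,\dots\}$ such that $\varphi_\gamma(x^{k+1})\le\varphi_\gamma(x^k)-\sigma\|R_\gamma(x^k)\|^2$, where $x^{k+1}=(1-\tau_k)T_\gamma(x^k)+\tau_k(x^k+d^k)$. The algorithm is run with infinite accuracy, and it is assumed that $R_\gamma(x^k)\ne0$ for all $k$ (equivalently $x^k\notin\mathcal X_\star$), so that an infinite sequence is generated. The $(d^k)$ are superlinearly convergent directions if $\lim_{k\to\infty}\frac{\operatorname{dist}(x^k+d^k,\mathcal X_\star)}{\operatorname{dist}(x^k,\mathcal X_\star)}=0$, and superlinearly convergent directions with order $q>1$ if $\limsup_{k\to\infty}\frac{\operatorname{dist}(x^k+d^k,\mathcal X_\star)}{\operatorname{dist}(x^k,\mathcal X_\star)^q}<\infty$ (the latter being a strengthening of the former, i.e. required in addition to it). A sequence $a^k$ converges to $a$ superlinearly if $a^k=a$ for some $k$ or $\|a^{k+1}-a\|/\|a^k-a\|\to0$; superlinearly with order $q>1$ if moreover $\|a^{k+1}-a\|/\|a^k-a\|^q$ is bounded. *)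

theory Defs
  imports "HOL-Analysis.Analysis"
begin

section \<open>Convex analysis\<close>

definition gradient :: "(real^'n \<Rightarrow> real) \<Rightarrow> real^'n \<Rightarrow> real^'n" where
  "gradient f x = (THE D. GDERIV f x :> D)"

definition hessian :: "(real^'n \<Rightarrow> real) \<Rightarrow> real^'n \<Rightarrow> real^'n^'n" where
  "hessian f x = jacobian (gradient f) (at x)"

definition twice_continuously_differentiable :: "(real^'n \<Rightarrow> real) \<Rightarrow> bool" where
  "twice_continuously_differentiable f \<longleftrightarrow>
     (\<forall>x. f differentiable (at x)) \<and>
     (\<forall>x. gradient f differentiable (at x)) \<and>
     continuous_on UNIV (hessian f)"

definition proper_fun :: "('a \<Rightarrow> ereal) \<Rightarrow> bool" where
  "proper_fun g \<longleftrightarrow> (\<forall>x. g x \<noteq> -\<infinity>) \<and> (\<exists>x. g x \<noteq> \<infinity>)"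

text \<open>The library's \<open>convex_on\<close> is confined to real-valued functions.  Below it is only
  used for functions that avoid the value \<open>-\<infinity>\<close>, so no sum \<open>\<infinity> - \<infinity>\<close> arises.\<close>

definition convex_ereal :: "('a::real_vector \<Rightarrow> ereal) \<Rightarrow> bool" where
  "convex_ereal g \<longleftrightarrow>
     (\<forall>x y u v. 0 < u \<longrightarrow> 0 < v \<longrightarrow> u + v = 1 \<longrightarrow>
        g (u *\<^sub>R x + v *\<^sub>R y) \<le> ereal u * g x + ereal v * g y)"

definition lower_semicontinuous :: "('a::topological_space \<Rightarrow> ereal) \<Rightarrow> bool" where
  "lower_semicontinuous g \<longleftrightarrow> (\<forall>x. g x \<le> Liminf (at x) g)"

definition argmin :: "('a \<Rightarrow> ereal) \<Rightarrow> 'a set" where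
  "argmin h = {x. is_arg_min h (\<lambda>_. True) x}"

definition composite :: "('a \<Rightarrow> real) \<Rightarrow> ('a \<Rightarrow> ereal) \<Rightarrow> 'a \<Rightarrow> ereal" where
  "composite f g x = ereal (f x) + g x"

definition quadratic_growth :: "('a::metric_space \<Rightarrow> ereal) \<Rightarrow> real \<Rightarrow> real \<Rightarrow> bool" where
  "quadratic_growth h \<mu> \<beta> \<longleftrightarrow>
     (\<forall>x. h x \<le> (INF y. h y) + ereal \<beta> \<longrightarrow>
        h x - (INF y. h y) \<ge> ereal (\<mu> / 2 * (infdist x (argmin h))\<^sup>2))"

text \<open>For proper, convex, lower semicontinuous \<open>g\<close> and \<open>\<gamma> > 0\<close> the minimiser exists and is
  unique, so the choice made by \<open>ARG_MIN\<close> is immaterial.\<close>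

definition prox :: "real \<Rightarrow> (real^'n \<Rightarrow> ereal) \<Rightarrow> real^'n \<Rightarrow> real^'n" where
  "prox \<gamma> g x = (ARG_MIN (\<lambda>w. g w + ereal ((norm (w - x))\<^sup>2 / (2 * \<gamma>))) w. True)"

definition clarke_jacobian :: "(real^'n \<Rightarrow> real^'m) \<Rightarrow> real^'n \<Rightarrow> (real^'n^'m) set" where
  "clarke_jacobian G x = convex hull
     {J. \<exists>y :: nat \<Rightarrow> real^'n. (\<forall>j. G differentiable (at (y j))) \<and> y \<longlonglongrightarrow> x \<and>
           (\<lambda>j. jacobian G (at (y j))) \<longlonglongrightarrow> J}"

section \<open>Forward-backward operators and envelope\<close>

definition fb_step ::
    "real \<Rightarrow> (real^'n \<Rightarrow> real) \<Rightarrow> (real^'n \<Rightarrow> ereal) \<Rightarrow> real^'n \<Rightarrow> real^'n" where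
  "fb_step \<gamma> f g x = prox \<gamma> g (x - \<gamma> *\<^sub>R gradient f x)"

definition fb_residual ::
    "real \<Rightarrow> (real^'n \<Rightarrow> real) \<Rightarrow> (real^'n \<Rightarrow> ereal) \<Rightarrow> real^'n \<Rightarrow> real^'n" where
  "fb_residual \<gamma> f g x = (1 / \<gamma>) *\<^sub>R (x - fb_step \<gamma> f g x)"

definition fb_Q :: "real \<Rightarrow> (real^'n \<Rightarrow> real) \<Rightarrow> real^'n \<Rightarrow> real^'n^'n" where
  "fb_Q \<gamma> f x = mat 1 - \<gamma> *\<^sub>R hessian f x"

text \<open>The infimum is attained and finite when \<open>g\<close> is proper, convex and lower semicontinuous
  and \<open>\<gamma> > 0\<close>, so \<open>real_of_ereal\<close> loses nothing.\<close>

definition fb_envelope ::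
    "real \<Rightarrow> (real^'n \<Rightarrow> real) \<Rightarrow> (real^'n \<Rightarrow> ereal) \<Rightarrow> real^'n \<Rightarrow> real" where
  "fb_envelope \<gamma> f g x = real_of_ereal
     (INF w. ereal (f x + gradient f x \<bullet> (w - x) + (norm (w - x))\<^sup>2 / (2 * \<gamma>)) + g w)"

definition approx_gen_hessian ::
    "real \<Rightarrow> (real^'n \<Rightarrow> real) \<Rightarrow> (real^'n \<Rightarrow> ereal) \<Rightarrow> real^'n \<Rightarrow> (real^'n^'n) set" where
  "approx_gen_hessian \<gamma> f g x =
     {(1 / \<gamma>) *\<^sub>R (fb_Q \<gamma> f x ** (mat 1 - P ** fb_Q \<gamma> f x)) | P.
        P \<in> clarke_jacobian (prox \<gamma> g) (x - \<gamma> *\<^sub>R gradient f x)}"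

section \<open>The algorithm\<close>

definition fbtn_next ::
    "real \<Rightarrow> (real^'n \<Rightarrow> real) \<Rightarrow> (real^'n \<Rightarrow> ereal) \<Rightarrow> real^'n \<Rightarrow> real^'n \<Rightarrow> real \<Rightarrow> real^'n" where
  "fbtn_next \<gamma> f g x d t = (1 - t) *\<^sub>R fb_step \<gamma> f g x + t *\<^sub>R (x + d)"

definition sufficient_decrease ::
    "real \<Rightarrow> real \<Rightarrow> (real^'n \<Rightarrow> real) \<Rightarrow> (real^'n \<Rightarrow> ereal) \<Rightarrow> real^'n \<Rightarrow> real^'n \<Rightarrow> bool" where
  "sufficient_decrease \<gamma> \<sigma> f g x z \<longleftrightarrow>
     fb_envelope \<gamma> f g z \<le> fb_envelope \<gamma> f g x - \<sigma> * (norm (fb_residual \<gamma> f g x))\<^sup>2"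

definition fbtn_params ::
    "real \<Rightarrow> real \<Rightarrow> real \<Rightarrow> real \<Rightarrow> real \<Rightarrow> real \<Rightarrow> real \<Rightarrow> bool" where
  "fbtn_params L \<gamma> \<sigma> \<eta>bar \<zeta> \<rho> \<nu> \<longleftrightarrow>
     0 < \<gamma> \<and> \<gamma> < 1 / L \<and>
     0 < \<sigma> \<and> \<sigma> < \<gamma> * (1 - \<gamma> * L) / 2 \<and>
     0 < \<eta>bar \<and> \<eta>bar < 1 \<and> 0 < \<zeta> \<and> \<zeta> < 1 \<and>
     0 < \<rho> \<and> \<rho> \<le> 1 \<and> 0 < \<nu> \<and> \<nu> \<le> 1"

definition inexact_newton_direction ::
    "real \<Rightarrow> real \<Rightarrow> real \<Rightarrow> real \<Rightarrow> real \<Rightarrow> (real^'n \<Rightarrow> real) \<Rightarrow> (real^'n \<Rightarrow> ereal) \<Rightarrow>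
      real^'n \<Rightarrow> real^'n \<Rightarrow> bool" where
  "inexact_newton_direction \<gamma> \<eta>bar \<zeta> \<rho> \<nu> f g x d \<longleftrightarrow>
     (let G = gradient (fb_envelope \<gamma> f g) x;
          \<delta> = \<zeta> * norm G powr \<nu>;
          \<eta> = min \<eta>bar (norm G powr \<rho>);
          \<epsilon> = \<eta> * norm G
      in \<exists>H \<in> approx_gen_hessian \<gamma> f g x. norm ((H + \<delta> *\<^sub>R mat 1) *v d + G) \<le> \<epsilon>)"

definition linesearch_stepsize ::
    "real \<Rightarrow> real \<Rightarrow> (real^'n \<Rightarrow> real) \<Rightarrow> (real^'n \<Rightarrow> ereal) \<Rightarrow>
      real^'n \<Rightarrow> real^'n \<Rightarrow> real \<Rightarrow> bool" where
  "linesearch_stepsize \<gamma> \<sigma> f g x d t \<longleftrightarrow>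
     (let S = {s. (\<exists>i::nat. s = (1/2) ^ i) \<and>
                  sufficient_decrease \<gamma> \<sigma> f g x (fbtn_next \<gamma> f g x d s)}
      in t \<in> S \<and> (\<forall>s\<in>S. s \<le> t))"

definition fbtn_run ::
    "real \<Rightarrow> real \<Rightarrow> real \<Rightarrow> real \<Rightarrow> real \<Rightarrow> real \<Rightarrow> (real^'n \<Rightarrow> real) \<Rightarrow> (real^'n \<Rightarrow> ereal) \<Rightarrow>
      (nat \<Rightarrow> real^'n) \<Rightarrow> (nat \<Rightarrow> real^'n) \<Rightarrow> (nat \<Rightarrow> real) \<Rightarrow> bool" where
  "fbtn_run \<gamma> \<sigma> \<eta>bar \<zeta> \<rho> \<nu> f g x d \<tau> \<longleftrightarrow>
     (\<forall>k. inexact_newton_direction \<gamma> \<eta>bar \<zeta> \<rho> \<nu> f g (x k) (d k) \<and>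
          linesearch_stepsize \<gamma> \<sigma> f g (x k) (d k) (\<tau> k) \<and>
          x (Suc k) = fbtn_next \<gamma> f g (x k) (d k) (\<tau> k))"

section \<open>Superlinear convergence\<close>

definition superlinear_directions ::
    "'a::real_normed_vector set \<Rightarrow> (nat \<Rightarrow> 'a) \<Rightarrow> (nat \<Rightarrow> 'a) \<Rightarrow> bool" where
  "superlinear_directions X x d \<longleftrightarrow>
     (\<lambda>k. infdist (x k + d k) X / infdist (x k) X) \<longlonglongrightarrow> 0"

definition superlinear_directions_order ::
    "real \<Rightarrow> 'a::real_normed_vector set \<Rightarrow> (nat \<Rightarrow> 'a) \<Rightarrow> (nat \<Rightarrow> 'a) \<Rightarrow> bool" where
  "superlinear_directions_order q X x d \<longleftrightarrow>
     superlinear_directions X x d \<and>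
     limsup (\<lambda>k. ereal (infdist (x k + d k) X / infdist (x k) X powr q)) < \<infinity>"

definition converges_superlinearly ::
    "(nat \<Rightarrow> 'a::real_normed_vector) \<Rightarrow> 'a \<Rightarrow> bool" where
  "converges_superlinearly a l \<longleftrightarrow>
     a \<longlonglongrightarrow> l \<and>
     ((\<exists>k. a k = l) \<or> (\<lambda>k. norm (a (Suc k) - l) / norm (a k - l)) \<longlonglongrightarrow> 0)"

definition converges_superlinearly_order ::
    "real \<Rightarrow> (nat \<Rightarrow> 'a::real_normed_vector) \<Rightarrow> 'a \<Rightarrow> bool" where
  "converges_superlinearly_order q a l \<longleftrightarrow>
     converges_superlinearly a l \<and>
     bounded (range (\<lambda>k. norm (a (Suc k) - l) / norm (a k - l) powr q))"

end

theory Submission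
  imports Defs
begin

text \<open>Convexity of \<open>f\<close> bounds the gap of the envelope at a point
  \<open>z\<close> by \<open>dist(z, X)\<^sup>2 / (2\<gamma>)\<close>, which at \<open>z = x\<^sub>k + d\<^sub>k\<close> is \<open>o(dist(x\<^sub>k, X)\<^sup>2)\<close>; at \<open>x\<^sub>k\<close> the gap is at
  least \<open>\<gamma>(1 - \<gamma>L)/2 \<parallel>R(x\<^sub>k)\<parallel>\<^sup>2\<close> by the descent lemma.  The two are compared through the error bound
  \<open>dist(x, X) = O(\<parallel>R(x)\<parallel>)\<close>, which quadratic growth yields wherever \<open>\<parallel>R(x)\<parallel>\<close> is small.  The
  line search makes \<open>R(x\<^sub>k)\<close> tend to \<open>0\<close>, so eventually the error bound applies and the unit step
  is accepted.\<close>

section \<open>Smooth convex functions\<close>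

text \<open>\<open>gradient\<close> is a definite description. Linearity makes the vector of partial
  derivatives represent the derivative; two representing vectors agree on testing with their
  difference.\<close>

lemma GDERIV_gradient:
  fixes f :: "real^'n \<Rightarrow> real"
  assumes "f differentiable (at x)"
  shows "GDERIV f x :> gradient f x"
proof -
  obtain f' where f': "(f has_derivative f') (at x)"
    using assms by (auto simp: differentiable_def)
  then have lin: "linear f'"
    by (rule has_derivative_linear)
  define D where "D = (\<chi> i. f' (axis i 1))"
  have "f' = (\<lambda>h. h \<bullet> D)"
  proof
    fix h
    have "f' h = f' (\<Sum>i\<in>UNIV. h $ i *\<^sub>R axis i 1)"
      using basis_expansion[of h] by (simp add: scalar_mult_eq_scaleR)
    also have "\<dots> = (\<Sum>i\<in>UNIV. h $ i * f' (axis i 1))"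
      by (simp add: linear_sum[OF lin] linear_cmul[OF lin])
    finally show "f' h = h \<bullet> D"
      by (simp add: inner_vec_def D_def)
  qed
  then have "GDERIV f x :> D"
    using f' by (simp add: gderiv_def)
  moreover have "E = D" if "GDERIV f x :> E" for E
  proof -
    have "(\<lambda>h. h \<bullet> E) = (\<lambda>h. h \<bullet> D)"
      using that \<open>GDERIV f x :> D\<close> unfolding gderiv_def by (rule has_derivative_unique)
    then have "(E - D) \<bullet> (E - D) = 0"
      by (metis inner_diff_right right_minus_eq)
    then show ?thesis
      by simp
  qed
  ultimately show ?thesis
    unfolding gradient_def by (metis theI)
qed

lemma DERIV_along_line:
  fixes f :: "real^'n \<Rightarrow> real"
  assumes "f differentiable (at (x + t *\<^sub>R v))"
  shows "((\<lambda>t. f (x + t *\<^sub>R v)) has_real_derivative gradient f (x + t *\<^sub>R v) \<bullet> v) (at t)"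
proof -
  have f: "(f has_derivative (\<lambda>h. h \<bullet> gradient f (x + t *\<^sub>R v))) (at (x + t *\<^sub>R v))"
    using GDERIV_gradient[OF assms] by (simp add: gderiv_def)
  have line: "((\<lambda>t. x + t *\<^sub>R v) has_derivative (\<lambda>h. h *\<^sub>R v)) (at t)"
    by (auto intro!: derivative_eq_intros)
  have "(\<lambda>h. (h *\<^sub>R v) \<bullet> gradient f (x + t *\<^sub>R v)) = (*) (gradient f (x + t *\<^sub>R v) \<bullet> v)"
    by (rule ext) (simp add: inner_commute)
  then show ?thesis
    using has_derivative_compose[OF line f] by (simp add: has_field_derivative_def)
qed

text \<open>Restriction to the line through \<open>x\<close> and \<open>w\<close> reduces this to a
  convex function of one variable lying above its tangent at 0.\<close>

lemma convex_gradient_inequality: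
  fixes f :: "real^'n \<Rightarrow> real"
  assumes "convex_on UNIV f" and diff: "\<And>x. f differentiable (at x)"
  shows "f x + gradient f x \<bullet> (w - x) \<le> f w"
proof -
  let ?v = "w - x"
  have "convex_on UNIV (\<lambda>t. f (x + t *\<^sub>R ?v))"
  proof (rule convex_onI)
    fix t a b :: real
    assume "0 < t" "t < 1"
    then have "f ((1 - t) *\<^sub>R (x + a *\<^sub>R ?v) + t *\<^sub>R (x + b *\<^sub>R ?v))
        \<le> (1 - t) * f (x + a *\<^sub>R ?v) + t * f (x + b *\<^sub>R ?v)"
      using assms(1) by (intro convex_onD) auto
    moreover have "(1 - t) *\<^sub>R (x + a *\<^sub>R ?v) + t *\<^sub>R (x + b *\<^sub>R ?v)
        = x + ((1 - t) *\<^sub>R a + t *\<^sub>R b) *\<^sub>R ?v"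
      by (simp add: algebra_simps)
    ultimately show "f (x + ((1 - t) *\<^sub>R a + t *\<^sub>R b) *\<^sub>R ?v)
        \<le> (1 - t) * f (x + a *\<^sub>R ?v) + t * f (x + b *\<^sub>R ?v)"
      by simp
  qed simp
  then have "f (x + 1 *\<^sub>R ?v) - f (x + 0 *\<^sub>R ?v) \<ge> (gradient f x \<bullet> ?v) * (1 - 0)"
    using DERIV_along_line[of f x 0 ?v] diff
    by (intro convex_on_imp_above_tangent[of UNIV]) auto
  then show ?thesis
    by simp
qed

text \<open>Along the segment, \<open>h\<close> is \<open>f\<close> minus the claimed upper bound,
  up to a constant. Its derivative is nonpositive by Cauchy-Schwarz and the Lipschitz bound.\<close>

lemma descent_lemma:
  fixes f :: "real^'n \<Rightarrow> real"
  assumes diff: "\<And>x. f differentiable (at x)" and lip: "L-lipschitz_on UNIV (gradient f)"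
  shows "f w \<le> f x + gradient f x \<bullet> (w - x) + L / 2 * (norm (w - x))\<^sup>2"
proof -
  define v where "v = w - x"
  define h where "h = (\<lambda>t. f (x + t *\<^sub>R v) - t * (gradient f x \<bullet> v) - L / 2 * t\<^sup>2 * (norm v)\<^sup>2)"
  have "\<exists>y. (h has_real_derivative y) (at t) \<and> y \<le> 0" if "0 \<le> t" for t
  proof (intro exI conjI)
    show "(h has_real_derivative gradient f (x + t *\<^sub>R v) \<bullet> v - gradient f x \<bullet> v
        - L * t * (norm v)\<^sup>2) (at t)"
      unfolding h_def
      by (auto intro!: derivative_eq_intros DERIV_along_line diff simp: algebra_simps)
    have "(gradient f (x + t *\<^sub>R v) - gradient f x) \<bullet> v
        \<le> norm (gradient f (x + t *\<^sub>R v) - gradient f x) * norm v"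
      by (rule norm_cauchy_schwarz)
    also have "\<dots> \<le> (L * norm (t *\<^sub>R v)) * norm v"
      using lipschitz_onD[OF lip, of "x + t *\<^sub>R v" x]
      by (intro mult_right_mono) (auto simp: dist_norm)
    finally show "gradient f (x + t *\<^sub>R v) \<bullet> v - gradient f x \<bullet> v - L * t * (norm v)\<^sup>2 \<le> 0"
      using that by (simp add: power2_eq_square algebra_simps)
  qed
  then have "h 1 \<le> h 0"
    by (intro DERIV_nonpos_imp_nonincreasing[where f = h and a = 0 and b = 1]) auto
  then show ?thesis
    by (simp add: h_def v_def)
qed

section \<open>Lower semicontinuous functions\<close>

lemma lower_semicontinuous_add_real:
  assumes "lower_semicontinuous g" and "continuous_on UNIV c"
  shows "lower_semicontinuous (\<lambda>w. g w + ereal (c w))"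
  unfolding lower_semicontinuous_def le_Liminf_iff
proof (intro allI impI)
  fix x y
  assume "y < g x + ereal (c x)"
  then obtain s where s: "y < ereal s" "ereal s < g x + ereal (c x)"
    using ereal_dense2 by blast
  \<comment> \<open>The threshold \<open>s\<close> is split into \<open>r\<close>, strictly below
    \<open>g x\<close>, and \<open>s - r\<close>, strictly below \<open>c x\<close>; each part
    persists near \<open>x\<close>.\<close>
  then have "ereal (s - c x) < g x"
    by (cases "g x") auto
  then obtain r where r: "ereal (s - c x) < ereal r" "ereal r < g x"
    using ereal_dense2 by blast
  have "\<forall>\<^sub>F w in at x. ereal r < g w"
    using assms(1) r(2) by (simp add: lower_semicontinuous_def le_Liminf_iff)
  moreover have "\<forall>\<^sub>F w in at x. s - r < c w"
    using assms(2) r(1)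
    by (intro order_tendstoD(1)[where y = "c x"]) (auto simp: continuous_on_def)
  ultimately show "\<forall>\<^sub>F w in at x. y < g w + ereal (c w)"
  proof eventually_elim
    case (elim w)
    then have "ereal s < g w + ereal (c w)"
      by (cases "g w") auto
    then show ?case
      using s(1) by simp
  qed
qed

lemma lower_semicontinuous_closed_sublevel:
  assumes "lower_semicontinuous h"
  shows "closed {w. h w \<le> a}"
proof -
  have "\<exists>T. open T \<and> x \<in> T \<and> T \<subseteq> {w. a < h w}" if "a < h x" for x
  proof -
    have "\<forall>\<^sub>F w in at x. a < h w"
      using assms that by (simp add: lower_semicontinuous_def le_Liminf_iff)
    \<comment> \<open>The filter \<open>at x\<close> omits \<open>x\<close> itself, where
      \<open>a < h x\<close> holds by assumption.\<close>
    then show ?thesis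
      using that by (auto simp: eventually_at_topological)
  qed
  then have "open {w. a < h w}"
    by (subst open_subopen) blast
  moreover have "{w. h w \<le> a} = - {w. a < h w}"
    by auto
  ultimately show ?thesis
    by (simp add: closed_def)
qed

text \<open>The minimisers form the intersection of all sublevel sets at attained values. Finitely
  many of these share the point of smallest value among the chosen ones, so compactness
  applies.\<close>

lemma lower_semicontinuous_attains_min:
  fixes h :: "'a::heine_borel \<Rightarrow> ereal"
  assumes "lower_semicontinuous h" and "bounded {w. h w \<le> h w0}"
  obtains w where "\<And>v. h w \<le> h v"
proof -
  define S where "S = (\<lambda>v. {w. h w \<le> h v})"
  have clS: "closed (S v)" for v
    using assms(1) by (simp add: S_def lower_semicontinuous_closed_sublevel)
  have "compact (S w0)"
    using clS assms(2) by (simp add: compact_eq_bounded_closed S_def)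
  moreover have "S w0 \<inter> \<Inter>F \<noteq> {}" if F: "finite F" "F \<subseteq> range S" for F
  proof -
    obtain V where V: "finite V" "F = S ` V"
      using finite_subset_image[OF F] by blast
    obtain u where u: "u \<in> insert w0 V" "h u = Min (h ` insert w0 V)"
      using V(1) Min_in[of "h ` insert w0 V"] by fastforce
    have "h u \<le> h v" if "v \<in> insert w0 V" for v
      unfolding u(2) using V(1) that by (intro Min_le) auto
    then have "u \<in> S w0 \<inter> \<Inter>F"
      unfolding V(2) S_def by simp
    then show ?thesis
      by blast
  qed
  ultimately have "S w0 \<inter> \<Inter>(range S) \<noteq> {}"
    using clS compact_imp_fip[of "S w0" "range S"] by blast
  then obtain w where "\<And>v. w \<in> S v"
    by blast
  then show ?thesis
    using that[of w] by (simp add: S_def)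
qed

text \<open>Passes bounds valid for each minimiser to the distance, so that no nearest minimiser has
  to be produced.\<close>

lemma le_mult_infdist:
  assumes "X \<noteq> {}" and "0 \<le> C" and "\<And>w. w \<in> X \<Longrightarrow> a \<le> C * dist y w"
  shows "a \<le> C * infdist y X"
proof (cases "C = 0")
  case True
  then show ?thesis
    using assms by auto
next
  case False
  then have "a / C \<le> infdist y X"
    using assms unfolding infdist_notempty[OF assms(1)]
    by (intro cINF_greatest) (auto simp: pos_divide_le_eq mult.commute)
  then show ?thesis
    using False assms(2) by (simp add: field_simps)
qed

section \<open>Forward-backward steps\<close>

locale forward_backward =
  fixes f :: "real^'n \<Rightarrow> real" and g :: "real^'n \<Rightarrow> ereal" and L \<gamma> :: real
  assumes convex_f: "convex_on UNIV f"
    and differentiable_f: "\<And>x. f differentiable (at x)"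
    and lipschitz_f: "L-lipschitz_on UNIV (gradient f)"
    and proper_g: "proper_fun g"
    and convex_g: "convex_ereal g"
    and lsc_g: "lower_semicontinuous g"
    and argmin_nonempty: "argmin (composite f g) \<noteq> {}"
    and \<gamma>_pos: "0 < \<gamma>"
    and \<gamma>_less: "\<gamma> * L < 1"
begin

abbreviation "X \<equiv> argmin (composite f g)"
abbreviation "T \<equiv> fb_step \<gamma> f g"
abbreviation "R \<equiv> fb_residual \<gamma> f g"
abbreviation "env \<equiv> fb_envelope \<gamma> f g"

text \<open>Real stand-ins for extended-real values; \<open>Inf_composite\<close> and
  \<open>g_fb_step\<close> show that the conversion loses nothing.\<close>

definition opt :: real where "opt = real_of_ereal (INF y. composite f g y)"
definition gT :: "real^'n \<Rightarrow> real" where "gT x = real_of_ereal (g (T x))"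
text \<open>The objective of the envelope without \<open>g\<close>, so that it stays
  real-valued.\<close>

definition model :: "real^'n \<Rightarrow> real^'n \<Rightarrow> real" where
  "model x w = f x + gradient f x \<bullet> (w - x) + (norm (w - x))\<^sup>2 / (2 * \<gamma>)"

section \<open>Finiteness of the optimal value\<close>

lemma g_not_MInf [simp]: "g w \<noteq> -\<infinity>"
  using proper_g by (simp add: proper_fun_def)

lemma g_convex_combination:
  "0 < t \<Longrightarrow> t < 1 \<Longrightarrow> g ((1 - t) *\<^sub>R a + t *\<^sub>R b) \<le> ereal (1 - t) * g a + ereal t * g b"
  using convex_g[unfolded convex_ereal_def, rule_format, of "1 - t" t] by simp

lemma Inf_composite: "(INF y. composite f g y) = ereal opt"
  and argmin_value: "w \<in> X \<Longrightarrow> g w = ereal (opt - f w)"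
proof -
  have inf: "(INF y. composite f g y) = composite f g w" if "w \<in> X" for w
    using that by (intro antisym INF_lower INF_greatest)
      (auto simp: argmin_def is_arg_min_def not_less)
  obtain w where w: "w \<in> X"
    using argmin_nonempty by blast
  obtain u where "g u \<noteq> \<infinity>"
    using proper_g by (auto simp: proper_fun_def)
  moreover have "composite f g w \<le> composite f g u"
    by (metis inf w INF_lower UNIV_I)
  ultimately have "g w \<noteq> \<infinity>"
    by (auto simp: composite_def)
  then obtain r where "g w = ereal r"
    using g_not_MInf by (cases "g w") auto
  then show val: "(INF y. composite f g y) = ereal opt"
    unfolding opt_def inf[OF w] by (simp add: composite_def)
  show "g w = ereal (opt - f w)" if "w \<in> X" for w
    using inf[OF that] val g_not_MInf[of w] by (cases "g w") (auto simp: composite_def)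
qed

section \<open>Existence of forward-backward steps\<close>

lemma g_lower: "ereal (opt - f w) \<le> g w"
proof -
  have "ereal opt \<le> composite f g w"
    by (metis Inf_composite INF_lower UNIV_I)
  then show ?thesis
    by (cases "g w") (auto simp: composite_def)
qed

text \<open>Since \<open>g \<ge> opt - f\<close>, the descent lemma bounds the model from below by a quadratic that is
  coercive because \<open>\<gamma> < 1 / L\<close>; no affine minorant of \<open>g\<close> is needed.\<close>

lemma model_minimizer_exists:
  obtains w where "\<And>v. g w + ereal (model x w) \<le> g v + ereal (model x v)"
proof -
  define h where "h = (\<lambda>w. g w + ereal (model x w))"
  have lsc: "lower_semicontinuous h"
    unfolding h_def using lsc_g
    by (rule lower_semicontinuous_add_real) (use \<gamma>_pos in \<open>auto simp: model_def intro!: continuous_intros\<close>)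
  obtain w0 where w0: "w0 \<in> X"
    using argmin_nonempty by blast
  define a where "a = opt - f w0 + model x w0"
  have ha: "h w0 = ereal a"
    using argmin_value[OF w0] by (simp add: h_def a_def)
  define c where "c = 1 / (2 * \<gamma>) - L / 2"
  have c: "c > 0"
    using \<gamma>_pos \<gamma>_less by (simp add: c_def field_simps)
  have "norm (w - x) \<le> sqrt ((a - opt) / c)" if "h w \<le> h w0" for w
  proof -
    have "ereal (opt - f w + model x w) \<le> h w"
      using add_right_mono[OF g_lower[of w], of "ereal (model x w)"] by (simp add: h_def)
    then have "opt - f w + model x w \<le> a"
      using that ha by (metis ereal_less_eq(3) order_trans)
    moreover have "opt - f w + model x w \<ge> opt + c * (norm (w - x))\<^sup>2"
      using descent_lemma[OF differentiable_f lipschitz_f, of w x]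
      by (simp add: model_def c_def algebra_simps)
    ultimately have "(norm (w - x))\<^sup>2 \<le> (a - opt) / c"
      using c by (simp add: field_simps)
    then show ?thesis
      by (rule real_le_rsqrt)
  qed
  then have "{w. h w \<le> h w0} \<subseteq> cball x (sqrt ((a - opt) / c))"
    by (auto simp: dist_norm norm_minus_commute)
  then have "bounded {w. h w \<le> h w0}"
    using bounded_cball bounded_subset by blast
  then show ?thesis
    using lower_semicontinuous_attains_min[OF lsc] that unfolding h_def by blast
qed

text \<open>Completing the square shows that the model differs from the proximal term at the forward
  point only by the constant \<open>k\<close>. Once a minimiser exists, the choice made in
  \<open>prox\<close> is one.\<close>

lemma fb_step_minimizes: "g (T x) + ereal (model x (T x)) \<le> g v + ereal (model x v)"
proof -
  define k where "k = f x - \<gamma> / 2 * (norm (gradient f x))\<^sup>2"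
  define p where "p = (\<lambda>w. g w + ereal ((norm (w - (x - \<gamma> *\<^sub>R gradient f x)))\<^sup>2 / (2 * \<gamma>)))"
  have mod: "model x w = (norm (w - (x - \<gamma> *\<^sub>R gradient f x)))\<^sup>2 / (2 * \<gamma>) + k" for w
  proof -
    have "(norm (w - (x - \<gamma> *\<^sub>R gradient f x)))\<^sup>2
        = (norm ((w - x) + \<gamma> *\<^sub>R gradient f x))\<^sup>2"
      by (simp add: algebra_simps)
    also have "\<dots> = (norm (w - x))\<^sup>2 + 2 * \<gamma> * (gradient f x \<bullet> (w - x))
        + \<gamma>\<^sup>2 * (norm (gradient f x))\<^sup>2"
      unfolding power2_norm_eq_inner
      by (simp add: inner_commute inner_add_left inner_add_right power2_eq_square)
    finally show ?thesis
      using \<gamma>_pos by (simp add: model_def k_def field_simps power2_eq_square)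
  qed
  have p: "g w + ereal (model x w) = p w + ereal k" for w
    unfolding p_def mod by (simp add: add.assoc)
  obtain w where "\<And>v. g w + ereal (model x w) \<le> g v + ereal (model x v)"
    using model_minimizer_exists by blast
  then have "is_arg_min p (\<lambda>_. True) w"
    by (auto simp: p is_arg_min_def not_less ereal_add_le_add_iff2)
  then have "is_arg_min p (\<lambda>_. True) (T x)"
    unfolding fb_step_def prox_def p_def[symmetric] arg_min_def by (rule someI)
  then show ?thesis
    unfolding p by (intro add_right_mono) (auto simp: is_arg_min_def not_less)
qed

lemma g_fb_step: "g (T x) = ereal (gT x)"
proof -
  obtain w where "w \<in> X"
    using argmin_nonempty by blast
  then have "g (T x) \<noteq> \<infinity>"
    using fb_step_minimizes[of x w] argmin_value by auto
  then show ?thesis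
    using g_not_MInf[of "T x"] by (cases "g (T x)") (auto simp: gT_def)
qed

lemma fb_step_le: "g v = ereal r \<Longrightarrow> gT x + model x (T x) \<le> r + model x v"
  using fb_step_minimizes[of x v] by (simp add: g_fb_step)

lemma envelope_eq: "env x = gT x + model x (T x)"
proof -
  have "(INF w. ereal (model x w) + g w) = ereal (model x (T x)) + g (T x)"
    using fb_step_minimizes[of x] by (intro antisym INF_lower INF_greatest) (auto simp: add.commute)
  then show ?thesis
    unfolding fb_envelope_def model_def[symmetric] by (simp add: g_fb_step)
qed

section \<open>The residual as a source of subgradients\<close>

lemma diff_fb_step: "x - T x = \<gamma> *\<^sub>R R x"
  using \<gamma>_pos by (simp add: fb_residual_def)

lemma norm_fb_step: "norm (T x - x) = \<gamma> * norm (R x)"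
  using diff_fb_step[of x] \<gamma>_pos by (metis abs_of_pos norm_minus_commute norm_scaleR)

text \<open>Compare \<open>T x\<close> with \<open>T x + t (w - T x)\<close> and let \<open>t\<close> tend to \<open>0\<close>.\<close>

lemma fb_step_subgradient:
  assumes "g w = ereal r"
  shows "gT x + (R x - gradient f x) \<bullet> (w - T x) \<le> r"
proof -
  define v where "v = w - T x"
  have "gT x + (R x - gradient f x) \<bullet> v \<le> r + t * ((norm v)\<^sup>2 / (2 * \<gamma>))" if t: "0 < t" "t < 1" for t
  proof -
    define z where "z = (1 - t) *\<^sub>R T x + t *\<^sub>R w"
    have "g z \<le> ereal (1 - t) * g (T x) + ereal t * g w"
      unfolding z_def using t by (intro g_convex_combination)
    then have gz: "g z \<le> ereal ((1 - t) * gT x + t * r)"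
      by (simp add: g_fb_step assms)
    then obtain s where s: "g z = ereal s"
      using g_not_MInf[of z] by (cases "g z") auto
    have zx: "z - x = (T x - x) + t *\<^sub>R v"
      by (simp add: z_def v_def algebra_simps)
    have "(norm (z - x))\<^sup>2 = (norm (T x - x))\<^sup>2 + 2 * t * ((T x - x) \<bullet> v) + t\<^sup>2 * (norm v)\<^sup>2"
      unfolding zx power2_norm_eq_inner
      by (simp add: inner_commute inner_add_left inner_add_right power2_eq_square)
    moreover have "(T x - x) \<bullet> v = - \<gamma> * (R x \<bullet> v)"
      using diff_fb_step[of x] by (metis inner_minus_left inner_scaleR_left minus_diff_eq mult_minus_left)
    moreover have "gradient f x \<bullet> (z - x) = gradient f x \<bullet> (T x - x) + t * (gradient f x \<bullet> v)"
      by (simp add: zx inner_add_right)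
    ultimately have "model x z = model x (T x) + t * (gradient f x \<bullet> v) - t * (R x \<bullet> v)
        + t * (t * ((norm v)\<^sup>2 / (2 * \<gamma>)))"
      using \<gamma>_pos unfolding model_def
      by (simp add: add_divide_distrib diff_divide_distrib power2_eq_square)
    moreover have "gT x + model x (T x) \<le> s + model x z"
      by (rule fb_step_le[OF s])
    ultimately have "t * (gT x + (R x - gradient f x) \<bullet> v) \<le> t * (r + t * ((norm v)\<^sup>2 / (2 * \<gamma>)))"
      using gz s by (simp add: algebra_simps inner_diff_left)
    then show ?thesis
      using t by simp
  qed
  then have "\<forall>\<^sub>F t in at_right 0. gT x + (R x - gradient f x) \<bullet> v \<le> r + t * ((norm v)\<^sup>2 / (2 * \<gamma>))"
    unfolding eventually_at_right_field by (intro exI[of _ 1]) auto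
  moreover have "((\<lambda>t. r + t * ((norm v)\<^sup>2 / (2 * \<gamma>))) \<longlongrightarrow> r) (at_right 0)"
    using \<gamma>_pos by (auto intro!: tendsto_eq_intros)
  ultimately show ?thesis
    unfolding v_def[symmetric]
    by (intro tendsto_lowerbound[OF _ _ trivial_limit_at_right_real])
qed

section \<open>Estimates of the optimality gap\<close>

lemma opt_le_fb_step: "opt \<le> f (T x) + gT x"
  using g_lower[of "T x"] by (simp add: g_fb_step)

text \<open>The model has curvature \<open>1 / \<gamma>\<close>, while the descent lemma needs only
  \<open>L\<close>. The surplus, at distance \<open>\<gamma> * norm (R x)\<close>, gives the
  constant.\<close>

lemma envelope_ge_value_fb_step:
  "f (T x) + gT x + \<gamma> * (1 - \<gamma> * L) / 2 * (norm (R x))\<^sup>2 \<le> env x"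
proof -
  have "f (T x) \<le> f x + gradient f x \<bullet> (T x - x) + L / 2 * (\<gamma> * norm (R x))\<^sup>2"
    using descent_lemma[OF differentiable_f lipschitz_f, of "T x" x] by (simp add: norm_fb_step)
  then show ?thesis
    using \<gamma>_pos by (simp add: envelope_eq model_def norm_fb_step field_simps power2_eq_square)
qed

lemma envelope_ge_opt: "opt + \<gamma> * (1 - \<gamma> * L) / 2 * (norm (R x))\<^sup>2 \<le> env x"
  using envelope_ge_value_fb_step[of x] opt_le_fb_step[of x] by simp

text \<open>Testing the model at a minimiser, convexity absorbs the linearisation of
  \<open>f\<close> and only the proximal term remains. Square roots make the bound linear in the
  distance, as \<open>le_mult_infdist\<close> requires.\<close>

lemma envelope_le_infdist: "env z - opt \<le> (infdist z X)\<^sup>2 / (2 * \<gamma>)"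
proof -
  have "0 \<le> \<gamma> * (1 - \<gamma> * L) / 2 * (norm (R z))\<^sup>2"
    using \<gamma>_pos \<gamma>_less by simp
  then have nonneg: "0 \<le> env z - opt"
    using envelope_ge_opt[of z] by simp
  have "sqrt (2 * \<gamma> * (env z - opt)) \<le> 1 * dist z w" if "w \<in> X" for w
  proof -
    have "env z \<le> opt - f w + model z w"
      unfolding envelope_eq using argmin_value[OF that] by (rule fb_step_le)
    also have "\<dots> \<le> opt + (norm (w - z))\<^sup>2 / (2 * \<gamma>)"
      using convex_gradient_inequality[OF convex_f differentiable_f, of z w] by (simp add: model_def)
    finally have "2 * \<gamma> * (env z - opt) \<le> (dist z w)\<^sup>2"
      using \<gamma>_pos by (simp add: field_simps dist_norm norm_minus_commute)
    then show ?thesis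
      by (simp add: real_le_lsqrt)
  qed
  then have "sqrt (2 * \<gamma> * (env z - opt)) \<le> 1 * infdist z X"
    using argmin_nonempty by (intro le_mult_infdist) auto
  then have "2 * \<gamma> * (env z - opt) \<le> (infdist z X)\<^sup>2"
    by (simp add: sqrt_le_D)
  then show ?thesis
    using \<gamma>_pos by (simp add: field_simps)
qed

text \<open>The vector \<open>v\<close> is a subgradient of the composite function at
  \<open>T x\<close>, and its norm is at most \<open>(1 + \<gamma> * L) * norm (R x)\<close>. The
  subgradient inequality towards a minimiser and Cauchy-Schwarz finish.\<close>

lemma value_fb_step_le: "f (T x) + gT x - opt \<le> 2 * norm (R x) * infdist (T x) X"
proof (rule le_mult_infdist)
  fix w assume w: "w \<in> X"
  define v where "v = R x - gradient f x + gradient f (T x)"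
  have "dist (gradient f (T x)) (gradient f x) \<le> L * dist (T x) x"
    using lipschitz_onD[OF lipschitz_f] by simp
  then have "norm v \<le> norm (R x) + L * (\<gamma> * norm (R x))"
    using norm_triangle_ineq[of "R x" "gradient f (T x) - gradient f x"]
    by (simp add: v_def dist_norm norm_fb_step algebra_simps)
  also have "\<dots> \<le> 2 * norm (R x)"
    using mult_right_mono[of "\<gamma> * L" 1 "norm (R x)"] \<gamma>_less by (simp add: algebra_simps)
  finally have v: "norm v \<le> 2 * norm (R x)" .
  have "f (T x) + gT x + v \<bullet> (w - T x) \<le> opt"
    using fb_step_subgradient[OF argmin_value[OF w], of x]
      convex_gradient_inequality[OF convex_f differentiable_f, of "T x" w]
    by (simp add: v_def algebra_simps)
  then have "f (T x) + gT x - opt \<le> - v \<bullet> (w - T x)"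
    by simp
  also have "\<dots> \<le> norm v * dist (T x) w"
    by (metis dist_norm norm_cauchy_schwarz norm_minus_cancel norm_minus_commute)
  also have "\<dots> \<le> 2 * norm (R x) * dist (T x) w"
    using v by (simp add: mult_right_mono)
  finally show "f (T x) + gT x - opt \<le> 2 * norm (R x) * dist (T x) w" .
qed (use argmin_nonempty in auto)

section \<open>Error bounds from quadratic growth\<close>

lemma quadratic_growth_real:
  assumes "quadratic_growth (composite f g) \<mu> \<beta>" and "g y = ereal r" and "f y + r - opt \<le> \<beta>"
  shows "\<mu> / 2 * (infdist y X)\<^sup>2 \<le> f y + r - opt"
  using assms(1)[unfolded quadratic_growth_def Inf_composite, rule_format, of y] assms(2,3)
  by (simp add: composite_def)

text \<open>Moving from \<open>y\<close> towards a minimiser until the value drops to \<open>opt + \<beta>\<close> turns the local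
  quadratic growth into linear growth far away from the minimisers.\<close>

lemma linear_growth:
  assumes growth: "quadratic_growth (composite f g) \<mu> \<beta>" and "\<mu> > 0" and "\<beta> > 0"
    and y: "g y = ereal r" and far: "f y + r - opt > \<beta>"
  shows "\<beta> * infdist y X \<le> sqrt (2 * \<beta> / \<mu>) * (f y + r - opt)"
proof -
  define \<Delta> where "\<Delta> = f y + r - opt"
  \<comment> \<open>Convexity bounds the gap at \<open>z\<close> below by
    \<open>t * \<Delta>\<close>, which this choice makes equal to \<open>\<beta>\<close>.\<close>
  define t where "t = \<beta> / \<Delta>"
  have t: "0 < t" "t < 1" "t * \<Delta> = \<beta>"
    using far \<open>\<beta> > 0\<close> by (auto simp: t_def \<Delta>_def)
  have "infdist y X - sqrt (2 * \<beta> / \<mu>) \<le> (1 - t) * dist y w" if w: "w \<in> X" for w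
  proof -
    define z where "z = (1 - t) *\<^sub>R w + t *\<^sub>R y"
    have "g z \<le> ereal (1 - t) * g w + ereal t * g y"
      unfolding z_def using t by (intro g_convex_combination)
    then have gz: "g z \<le> ereal ((1 - t) * (opt - f w) + t * r)"
      by (simp add: argmin_value[OF w] y)
    then obtain s where s: "g z = ereal s"
      using g_not_MInf[of z] by (cases "g z") auto
    have "f z \<le> (1 - t) * f w + t * f y"
      unfolding z_def using convex_f t by (intro convex_onD) auto
    then have le: "f z + s - opt \<le> \<beta>"
      using gz s t(3) by (simp add: \<Delta>_def algebra_simps)
    then have "\<mu> / 2 * (infdist z X)\<^sup>2 \<le> \<beta>"
      using quadratic_growth_real[OF growth s] by simp
    then have "(infdist z X)\<^sup>2 \<le> 2 * \<beta> / \<mu>"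
      using \<open>\<mu> > 0\<close> by (simp add: field_simps)
    then have "infdist z X \<le> sqrt (2 * \<beta> / \<mu>)"
      by (rule real_le_rsqrt)
    moreover have "infdist y X \<le> infdist z X + dist y z"
      by (rule infdist_triangle)
    moreover have "y - z = (1 - t) *\<^sub>R (y - w)"
      by (simp add: z_def algebra_simps)
    then have "dist y z = (1 - t) * dist y w"
      using t by (simp add: dist_norm)
    ultimately show ?thesis
      by simp
  qed
  then have "infdist y X - sqrt (2 * \<beta> / \<mu>) \<le> (1 - t) * infdist y X"
    using argmin_nonempty t by (intro le_mult_infdist) auto
  then have "t * infdist y X \<le> sqrt (2 * \<beta> / \<mu>)"
    by (simp add: algebra_simps)
  then have "\<Delta> * (t * infdist y X) \<le> \<Delta> * sqrt (2 * \<beta> / \<mu>)"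
    using far \<open>\<beta> > 0\<close> by (intro mult_left_mono) (auto simp: \<Delta>_def)
  then show ?thesis
    using t(3) by (simp add: \<Delta>_def[symmetric] mult.assoc[symmetric] mult.commute)
qed

text \<open>A small residual forces \<open>T x\<close> into the region of quadratic growth: outside
  it, \<open>linear_growth\<close> contradicts \<open>value_fb_step_le\<close>. Inside, the two
  bounds on the gap at \<open>T x\<close> give \<open>4 / \<mu>\<close>, and the step from
  \<open>T x\<close> back to \<open>x\<close> adds \<open>\<gamma>\<close>.\<close>

lemma residual_error_bound:
  assumes growth: "quadratic_growth (composite f g) \<mu> \<beta>" and "\<mu> > 0" and "\<beta> > 0"
    and small: "2 * sqrt (2 * \<beta> / \<mu>) * norm (R x) < \<beta>"
  shows "infdist x X \<le> (4 / \<mu> + \<gamma>) * norm (R x)"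
proof -
  let ?D = "infdist (T x) X"
  have D: "0 \<le> ?D"
    by (rule infdist_nonneg)
  have near: "f (T x) + gT x - opt \<le> \<beta>"
  proof (rule ccontr)
    assume "\<not> ?thesis"
    then have far: "f (T x) + gT x - opt > \<beta>"
      by simp
    then have "?D \<noteq> 0"
      using value_fb_step_le[of x] \<open>\<beta> > 0\<close> by auto
    have "\<beta> * ?D \<le> sqrt (2 * \<beta> / \<mu>) * (f (T x) + gT x - opt)"
      using linear_growth[OF growth \<open>\<mu> > 0\<close> \<open>\<beta> > 0\<close> g_fb_step far] .
    also have "\<dots> \<le> sqrt (2 * \<beta> / \<mu>) * (2 * norm (R x) * ?D)"
      using value_fb_step_le \<open>\<mu> > 0\<close> \<open>\<beta> > 0\<close> by (intro mult_left_mono) auto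
    also have "\<dots> = (2 * sqrt (2 * \<beta> / \<mu>) * norm (R x)) * ?D"
      by simp
    also have "\<dots> < \<beta> * ?D"
      using small D \<open>?D \<noteq> 0\<close> by (intro mult_strict_right_mono) auto
    finally show False
      by simp
  qed
  have "\<mu> / 2 * ?D\<^sup>2 \<le> 2 * norm (R x) * ?D"
    using quadratic_growth_real[OF growth g_fb_step near] value_fb_step_le[of x] by simp
  then have "?D * (\<mu> * ?D) \<le> ?D * (4 * norm (R x))"
    by (simp add: power2_eq_square algebra_simps)
  then have "\<mu> * ?D \<le> 4 * norm (R x)"
    using D by (cases "?D = 0") (auto simp: mult_le_cancel_left)
  then have "?D \<le> 4 / \<mu> * norm (R x)"
    using \<open>\<mu> > 0\<close> by (simp add: field_simps)
  moreover have "infdist x X \<le> ?D + dist x (T x)"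
    by (rule infdist_triangle)
  ultimately show ?thesis
    using norm_fb_step[of x] by (simp add: dist_norm norm_minus_commute algebra_simps)
qed

end

section \<open>Acceptance of the unit step\<close>

text \<open>The limsup controls a tail and the remaining terms are finitely many. Nonnegativity
  makes the one-sided bound a bound on the norm.\<close>

lemma limsup_finite_bounded_range:
  fixes a :: "nat \<Rightarrow> real"
  assumes "limsup (\<lambda>k. ereal (a k)) < \<infinity>" and "\<And>k. 0 \<le> a k"
  shows "bounded (range a)"
proof -
  obtain C where "limsup (\<lambda>k. ereal (a k)) < ereal C"
    using assms(1) ereal_dense2 by blast
  then have "\<forall>\<^sub>F k in sequentially. ereal (a k) < ereal C"
    by (rule Limsup_lessD)
  then have "\<forall>\<^sub>F k in sequentially. norm (a k) \<le> C"
    using assms(2) by (auto elim!: eventually_mono)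
  then show ?thesis
    using BfunI Bseq_eq_bounded by blast
qed

theorem theorem5p6:
  fixes f :: "real^'n \<Rightarrow> real" and g :: "real^'n \<Rightarrow> ereal"
    and L \<gamma> \<sigma> \<eta>bar \<zeta> \<rho> \<nu> \<mu> \<beta> :: real
    and x d :: "nat \<Rightarrow> real^'n" and \<tau> :: "nat \<Rightarrow> real"
  assumes "convex_on UNIV f" and "twice_continuously_differentiable f"
    and "L > 0" and "L-lipschitz_on UNIV (gradient f)"
    and "proper_fun g" and "convex_ereal g" and "lower_semicontinuous g"
    and "argmin (composite f g) \<noteq> {}"
    and "fbtn_params L \<gamma> \<sigma> \<eta>bar \<zeta> \<rho> \<nu>"
    and "fbtn_run \<gamma> \<sigma> \<eta>bar \<zeta> \<rho> \<nu> f g x d \<tau>"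
    and "\<And>k. fb_residual \<gamma> f g (x k) \<noteq> 0"
    and "\<mu> > 0" and "\<beta> > 0" and "quadratic_growth (composite f g) \<mu> \<beta>"
    and "superlinear_directions (argmin (composite f g)) x d"
  shows "(\<exists>kbar. \<forall>k\<ge>kbar.
            fb_envelope \<gamma> f g (x k + d k)
              \<le> fb_envelope \<gamma> f g (x k) - \<sigma> * (norm (fb_residual \<gamma> f g (x k)))\<^sup>2) \<and>
         (\<forall>\<^sub>F k in sequentially. x (Suc k) = x k + d k) \<and>
         converges_superlinearly (\<lambda>k. infdist (x k) (argmin (composite f g))) 0 \<and>
         (\<forall>q>1. superlinear_directions_order q (argmin (composite f g)) x d \<longrightarrow>
            converges_superlinearly_order q (\<lambda>k. infdist (x k) (argmin (composite f g))) 0)"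
proof -
  have \<gamma>: "0 < \<gamma>" "\<gamma> < 1 / L" and \<sigma>: "0 < \<sigma>" "\<sigma> < \<gamma> * (1 - \<gamma> * L) / 2"
    using assms(9) by (auto simp: fbtn_params_def)
  interpret forward_backward f g L \<gamma>
    by unfold_locales
      (use assms \<gamma> in \<open>simp_all add: twice_continuously_differentiable_def pos_less_divide_eq\<close>)
  \<comment> \<open>The slack between the constant in \<open>envelope_ge_opt\<close> and the
    decrease demanded by the line search.\<close>
  define c where "c = \<gamma> * (1 - \<gamma> * L) / 2 - \<sigma>"
  have c: "0 < c"
    using \<sigma> by (simp add: c_def)
  have decrease: "env (x (Suc k)) \<le> env (x k) - \<sigma> * (norm (R (x k)))\<^sup>2" for k
    using assms(10) by (auto simp: fbtn_run_def linesearch_stepsize_def sufficient_decrease_def Let_def)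

  \<comment> \<open>The envelope values decrease and are bounded below, so consecutive differences
    vanish; these dominate the squared residuals.\<close>
  have "decseq (\<lambda>k. env (x k))"
  proof (rule decseq_SucI)
    fix k
    have "0 \<le> \<sigma> * (norm (R (x k)))\<^sup>2"
      using \<sigma> by simp
    then show "env (x (Suc k)) \<le> env (x k)"
      using decrease[of k] by linarith
  qed
  moreover have "opt \<le> env (x k)" for k
    using envelope_ge_opt[of "x k"] \<gamma>_pos \<gamma>_less
    by (smt (verit) mult_nonneg_nonneg zero_le_power2 divide_nonneg_nonneg)
  ultimately obtain l where l: "(\<lambda>k. env (x k)) \<longlonglongrightarrow> l"
    using decseq_convergent[of "\<lambda>k. env (x k)" opt] by blast
  have "(\<lambda>k. (env (x k) - env (x (Suc k))) / \<sigma>) \<longlonglongrightarrow> (l - l) / \<sigma>"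
    using \<sigma> by (intro tendsto_intros l LIMSEQ_Suc) auto
  then have lim: "(\<lambda>k. (env (x k) - env (x (Suc k))) / \<sigma>) \<longlonglongrightarrow> 0"
    by simp
  have "(norm (R (x k)))\<^sup>2 \<le> (env (x k) - env (x (Suc k))) / \<sigma>" for k
    using decrease[of k] \<sigma> by (simp add: field_simps)
  then have "(\<lambda>k. (norm (R (x k)))\<^sup>2) \<longlonglongrightarrow> 0"
    by (intro tendsto_sandwich[OF _ _ tendsto_const lim]) auto
  then have "(\<lambda>k. sqrt ((norm (R (x k)))\<^sup>2)) \<longlonglongrightarrow> sqrt 0"
    by (rule tendsto_real_sqrt)
  then have R0: "(\<lambda>k. norm (R (x k))) \<longlonglongrightarrow> 0"
    by simp

  define K where "K = 4 / \<mu> + \<gamma>"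
  have K: "0 < K"
    using assms(12) \<gamma>_pos by (simp add: K_def add_pos_pos)
  have "(\<lambda>k. 2 * sqrt (2 * \<beta> / \<mu>) * norm (R (x k))) \<longlonglongrightarrow> 2 * sqrt (2 * \<beta> / \<mu>) * 0"
    by (intro tendsto_intros R0)
  then have "\<forall>\<^sub>F k in sequentially. 2 * sqrt (2 * \<beta> / \<mu>) * norm (R (x k)) < \<beta>"
    using assms(13) by (intro order_tendstoD(2)) auto
  then have bound: "\<forall>\<^sub>F k in sequentially. infdist (x k) X \<le> K * norm (R (x k))"
    unfolding K_def by (rule eventually_mono) (rule residual_error_bound[OF assms(14,12,13)])
  have "(\<lambda>k. K * norm (R (x k))) \<longlonglongrightarrow> K * 0"
    by (intro tendsto_intros R0)
  then have dist0: "(\<lambda>k. infdist (x k) X) \<longlonglongrightarrow> 0"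
    using bound by (intro tendsto_sandwich[OF _ bound tendsto_const]) (simp_all add: infdist_nonneg)

  \<comment> \<open>Chosen so that \<open>(\<epsilon> * K)\<^sup>2 / (2 * \<gamma>) = c\<close>: the
    envelope gap after a unit step is then at most \<open>c\<close> times the squared
    residual.\<close>
  define \<epsilon> where "\<epsilon> = sqrt (2 * \<gamma> * c) / K"
  have \<epsilon>: "0 < \<epsilon>"
    using \<gamma>_pos c K by (simp add: \<epsilon>_def)
  have dir: "(\<lambda>k. infdist (x k + d k) X / infdist (x k) X) \<longlonglongrightarrow> 0"
    using assms(15) by (simp add: superlinear_directions_def)
  then have "\<forall>\<^sub>F k in sequentially. infdist (x k + d k) X / infdist (x k) X < \<epsilon>"
    using \<epsilon> by (rule order_tendstoD(2))
  then have accept: "\<forall>\<^sub>F k in sequentially. env (x k + d k) \<le> env (x k) - \<sigma> * (norm (R (x k)))\<^sup>2"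
    using bound
  proof eventually_elim
    case (elim k)
    \<comment> \<open>With denominator 0 the quotient would be 0 and say nothing about
      \<open>d k\<close>. A nonzero residual keeps the envelope strictly above \<open>opt\<close>,
      hence the distance positive.\<close>
    have "infdist (x k) X \<noteq> 0"
    proof
      assume "infdist (x k) X = 0"
      then have "env (x k) \<le> opt"
        using envelope_le_infdist[of "x k"] by simp
      moreover have "0 < \<gamma> * (1 - \<gamma> * L) / 2 * (norm (R (x k)))\<^sup>2"
        using assms(11)[of k] \<gamma>_pos \<gamma>_less by simp
      ultimately show False
        using envelope_ge_opt[of "x k"] by simp
    qed
    then have "infdist (x k) X > 0"
      using infdist_nonneg[of "x k" X] by linarith
    then have "infdist (x k + d k) X \<le> \<epsilon> * infdist (x k) X"
      using elim(1) by (simp add: field_simps)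
    also have "\<dots> \<le> \<epsilon> * (K * norm (R (x k)))"
      using elim(2) \<epsilon> by simp
    also have "\<dots> = sqrt (2 * \<gamma> * c) * norm (R (x k))"
      using K by (simp add: \<epsilon>_def)
    finally have "(infdist (x k + d k) X)\<^sup>2 \<le> (sqrt (2 * \<gamma> * c) * norm (R (x k)))\<^sup>2"
      by (intro power_mono infdist_nonneg)
    also have "\<dots> = 2 * \<gamma> * c * (norm (R (x k)))\<^sup>2"
      using \<gamma>_pos c by (simp add: power_mult_distrib)
    finally have "(infdist (x k + d k) X)\<^sup>2 / (2 * \<gamma>) \<le> c * (norm (R (x k)))\<^sup>2"
      using \<gamma>_pos by (simp add: field_simps)
    \<comment> \<open>The envelope at the unit step is at most \<open>opt\<close> plus
      \<open>c\<close> times the squared residual; at \<open>x k\<close> it is at least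
      \<open>opt\<close> plus \<open>c + \<sigma>\<close> times it.\<close>
    then show ?case
      using envelope_le_infdist[of "x k + d k"] envelope_ge_opt[of "x k"]
      by (simp add: c_def left_diff_distrib)
  qed

  then have unit: "\<forall>\<^sub>F k in sequentially. x (Suc k) = x k + d k"
  proof eventually_elim
    case (elim k)
    define S where "S = {s. (\<exists>i::nat. s = (1/2) ^ i) \<and>
      sufficient_decrease \<gamma> \<sigma> f g (x k) (fbtn_next \<gamma> f g (x k) (d k) s)}"
    have \<tau>: "\<tau> k \<in> S" "\<forall>s\<in>S. s \<le> \<tau> k" and next_x: "x (Suc k) = fbtn_next \<gamma> f g (x k) (d k) (\<tau> k)"
      using assms(10) by (auto simp: fbtn_run_def linesearch_stepsize_def Let_def S_def)
    \<comment> \<open>The exponent 0 gives the largest candidate, so acceptance of the unit step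
      fixes \<open>\<tau> k = 1\<close> and the forward-backward part gets weight 0.\<close>
    have "1 \<in> S"
      using elim by (auto simp: S_def fbtn_next_def sufficient_decrease_def intro: exI[of _ 0])
    then have "1 \<le> \<tau> k"
      using \<tau>(2) by blast
    moreover obtain i :: nat where "\<tau> k = (1/2) ^ i"
      using \<tau>(1) by (auto simp: S_def)
    then have "\<tau> k \<le> 1"
      by (simp add: power_le_one)
    ultimately show ?case
      using next_x by (simp add: fbtn_next_def)
  qed

  have "(\<lambda>k. infdist (x (Suc k)) X / infdist (x k) X) \<longlonglongrightarrow> 0"
    by (rule Lim_transform_eventually[OF dir]) (use unit in eventually_elim, simp)
  then have superlinear: "converges_superlinearly (\<lambda>k. infdist (x k) X) 0"
    using dist0 by (simp add: converges_superlinearly_def infdist_nonneg)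

  have "converges_superlinearly_order q (\<lambda>k. infdist (x k) X) 0"
    if "superlinear_directions_order q X x d" for q
  proof -
    \<comment> \<open>The limsup sees only the tail, where all steps are unit steps; boundedness
      over all indices is recovered afterwards.\<close>
    have "limsup (\<lambda>k. ereal (infdist (x (Suc k)) X / infdist (x k) X powr q))
        = limsup (\<lambda>k. ereal (infdist (x k + d k) X / infdist (x k) X powr q))"
      by (rule Limsup_eq) (use unit in eventually_elim, simp)
    then have "bounded (range (\<lambda>k. infdist (x (Suc k)) X / infdist (x k) X powr q))"
      using that by (intro limsup_finite_bounded_range)
        (auto simp: superlinear_directions_order_def infdist_nonneg)
    then show ?thesis
      using superlinear by (simp add: converges_superlinearly_order_def infdist_nonneg)
  qed
  then show ?thesis
    using accept unit superlinear by (simp add: eventually_sequentially)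
qed

end
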